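(* Let $n\ge2$, $\alpha_n=\frac{n-1}{2}$ and let $\mathcal{D}_H=\sum_{i=1}^{n-1}e_iy\partial_{x_i}-\alpha_ne_n+e_ny\partial_y$ be the Dirac operator on the hyperbolic space. Then its square is given by $$\mathcal{D}_H^2=-y^2\Delta_n+e_n\mathcal{D}_H+2\alpha_ny\partial_y-\beta_n,$$ that is, $\mathcal{D}_H(\mathcal{D}_HF)=-y^2\Delta_nF+e_n\mathcal{D}_HF+2\alpha_ny\partial_yF-\beta_nF$ for every $F\in C^2(\Omega,\mathbb{R}_n)$, where $\Omega\subset\mathbb{R}^n_+$ is open, $\Delta_n=\sum_{i=1}^{n-1}\partial_{x_i}^2+\partial_y^2$ and $\beta_n=\alpha_n+\alpha_n^2=\frac{n-1}{2}+\frac{(n-1)^2}{4}$.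
   Context: $\mathbb{R}_n$ is the real Clifford algebra generated by $e_1,\dots,e_n$ with $e_i^2=-1$ and $e_ie_j=-e_je_i$ for $i\ne j$. $\mathbb{R}^n_+=\{(x,y): x=(x_1,\dots,x_{n-1})\in\mathbb{R}^{n-1},\ y>0\}$. Functions take values in $\mathbb{R}_n$, derivatives act componentwise, and the $e_i$ act by left multiplication. *)

theory Defs
  imports "HOL-Analysis.Analysis"
begin

section \<open>The real Clifford algebra\<close>

text \<open>
  For a linearly ordered finite index type \<open>'n\<close> with \<open>CARD('n) = n\<close>, an element of the Clifford
  algebra with \<open>n\<close> generators is stored by its \<open>2 ^ n\<close> coordinates with respect to the basis of
  blades \<open>e\<^sub>A = e\<^sub>i\<^sub>1 \<dots> e\<^sub>i\<^sub>k\<close>, where \<open>A = {i\<^sub>1 < \<dots> < i\<^sub>k}\<close>.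
\<close>

typedef 'n clifford = "UNIV :: ('n set \<Rightarrow> real) set"
  morphisms coord Clifford
  by simp

setup_lifting type_definition_clifford

lemma clifford_eqI: "(\<And>A. coord a A = coord b A) \<Longrightarrow> a = b"
  by (simp add: coord_inject[symmetric] ext)

lemma coord_Clifford [simp]: "coord (Clifford f) = f"
  by (simp add: Clifford_inverse)

instantiation clifford :: (finite) real_vector
begin

lift_definition zero_clifford :: "'a clifford" is "\<lambda>_. 0" .
lift_definition plus_clifford :: "'a clifford \<Rightarrow> 'a clifford \<Rightarrow> 'a clifford"
  is "\<lambda>a b A. a A + b A" .
lift_definition minus_clifford :: "'a clifford \<Rightarrow> 'a clifford \<Rightarrow> 'a clifford"
  is "\<lambda>a b A. a A - b A" .
lift_definition uminus_clifford :: "'a clifford \<Rightarrow> 'a clifford"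
  is "\<lambda>a A. - a A" .
lift_definition scaleR_clifford :: "real \<Rightarrow> 'a clifford \<Rightarrow> 'a clifford"
  is "\<lambda>r a A. r * a A" .

instance
  by (intro_classes; transfer; auto simp: algebra_simps)

end

lemma coord_simps [simp]:
  "coord 0 A = 0"
  "coord (a + b) A = coord a A + coord b A"
  "coord (a - b) A = coord a A - coord b A"
  "coord (- a) A = - coord a A"
  "coord (r *\<^sub>R a) A = r * coord a A"
  by (transfer; simp)+

lemma coord_sum: "coord (sum f S) A = (\<Sum>x\<in>S. coord (f x) A)"
  by (induction S rule: infinite_finite_induct) auto

definition blade :: "'n::finite set \<Rightarrow> 'n clifford"
  where "blade A = Clifford (\<lambda>B. if B = A then 1 else 0)"

lemma coord_blade [simp]: "coord (blade A) B = (if B = A then 1 else 0)"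
  by (simp add: blade_def)

instantiation clifford :: (finite) euclidean_space
begin

definition "inner a b = (\<Sum>A\<in>UNIV. coord a A * coord b A)"
definition "norm (a :: 'a clifford) = sqrt (inner a a)"
definition "dist (a :: 'a clifford) b = norm (a - b)"
definition "sgn (a :: 'a clifford) = a /\<^sub>R norm a"
definition [code del]: "(uniformity :: ('a clifford \<times> 'a clifford) filter) =
  (INF e\<in>{0<..}. principal {(a, b). dist a b < e})"
definition [code del]: "open (U :: 'a clifford set) \<longleftrightarrow>
  (\<forall>a\<in>U. \<forall>\<^sub>F (a', b) in uniformity. a' = a \<longrightarrow> b \<in> U)"
definition "(Basis :: 'a clifford set) = range blade"

instance
proof
  fix a b c :: "'a clifford" and r :: real and U :: "'a clifford set"
  show "dist a b = norm (a - b)"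
    by (rule dist_clifford_def)
  show "sgn a = a /\<^sub>R norm a"
    by (rule sgn_clifford_def)
  show "(uniformity :: ('a clifford \<times> 'a clifford) filter) =
      (INF e\<in>{0<..}. principal {(a, b). dist a b < e})"
    by (rule uniformity_clifford_def)
  show "open U \<longleftrightarrow> (\<forall>a\<in>U. \<forall>\<^sub>F (a', b) in uniformity. a' = a \<longrightarrow> b \<in> U)"
    by (rule open_clifford_def)
  show "inner a b = inner b a"
    by (simp add: inner_clifford_def mult.commute)
  show "inner (a + b) c = inner a c + inner b c"
    by (simp add: inner_clifford_def algebra_simps sum.distrib)
  show "inner (r *\<^sub>R a) b = r * inner a b"
    by (simp add: inner_clifford_def sum_distrib_left algebra_simps)
  show "0 \<le> inner a a"
    by (simp add: inner_clifford_def sum_nonneg)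
  show "inner a a = 0 \<longleftrightarrow> a = 0"
    by (auto simp: inner_clifford_def sum_nonneg_eq_0_iff intro: clifford_eqI)
  show "norm a = sqrt (inner a a)"
    by (rule norm_clifford_def)
  show "(Basis :: 'a clifford set) \<noteq> {}"
    by (simp add: Basis_clifford_def)
  show "finite (Basis :: 'a clifford set)"
    by (simp add: Basis_clifford_def)
  have inner_blade: "inner d (blade A) = coord d A" for d :: "'a clifford" and A
    by (simp add: inner_clifford_def if_distrib cong: if_cong)
  show "(\<forall>u\<in>Basis. inner a u = 0) \<longleftrightarrow> a = 0"
    by (auto simp: Basis_clifford_def inner_blade intro: clifford_eqI)
next
  fix u v :: "'a clifford"
  assume "u \<in> Basis" "v \<in> Basis"
  then obtain A B where "u = blade A" "v = blade B"
    by (auto simp: Basis_clifford_def)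
  moreover have "blade A = blade B \<longleftrightarrow> A = B" for A B :: "'a set"
    by (metis coord_blade zero_neq_one)
  moreover have "inner (blade A) (blade B) = (if A = B then 1 else 0)" for A B :: "'a set"
  proof -
    have "inner (blade A) (blade B) = (\<Sum>C\<in>UNIV. if C = A then if A = B then 1 else 0 else 0)"
      unfolding inner_clifford_def by (intro sum.cong) auto
    then show ?thesis
      by simp
  qed
  ultimately show "inner u v = (if u = v then 1 else 0)"
    by simp
qed

end

text \<open>
  Blades multiply by \<open>e\<^sub>A e\<^sub>B = \<plusminus> e\<^sub>C\<close>, where \<open>C\<close> is the symmetric difference of \<open>A\<close> and \<open>B\<close>: sorting
  the word produces a factor \<open>-1\<close> for each pair \<open>a \<in> A\<close>, \<open>b \<in> B\<close> with \<open>b < a\<close>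
  (from \<open>e\<^sub>a e\<^sub>b = - e\<^sub>b e\<^sub>a\<close>) and for each common index (from \<open>e\<^sub>a e\<^sub>a = -1\<close>).
\<close>

definition blade_sign :: "'n::{finite,linorder} set \<Rightarrow> 'n set \<Rightarrow> real"
  where "blade_sign A B = (\<Prod>a\<in>A. \<Prod>b\<in>B. if b \<le> a then -1 else 1)"

lemma prod_sym_diff:
  fixes f :: "'n::finite \<Rightarrow> real"
  assumes "\<And>x. f x * f x = 1"
  shows "prod f (sym_diff A B) = prod f A * prod f B"
proof -
  have ext: "prod f S = (\<Prod>x\<in>UNIV. if x \<in> S then f x else 1)" for S
    by (simp add: prod.If_cases)
  show ?thesis
    unfolding ext[of A] ext[of B] ext[of "sym_diff A B"] prod.distrib[symmetric]
    by (intro prod.cong) (auto simp: assms)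
qed

lemma blade_sign_sym_diff_left:
  "blade_sign (sym_diff A B) C = blade_sign A C * blade_sign B C"
  unfolding blade_sign_def
  by (rule prod_sym_diff) (simp add: prod.distrib[symmetric] if_distrib cong: if_cong)

lemma blade_sign_sym_diff_right:
  "blade_sign A (sym_diff B C) = blade_sign A B * blade_sign A C"
proof -
  have "(\<Prod>b\<in>sym_diff B C. if b \<le> a then -1 else 1 :: real) =
      (\<Prod>b\<in>B. if b \<le> a then -1 else 1) * (\<Prod>b\<in>C. if b \<le> a then -1 else 1)" for a
    by (rule prod_sym_diff) simp
  then show ?thesis
    by (simp add: blade_sign_def prod.distrib)
qed

lemma bij_sym_diff: "bij (sym_diff A)"
  by (rule o_bij[of "sym_diff A"]) auto

lemma sum_sym_diff: "(\<Sum>B\<in>UNIV. f (sym_diff A B)) = (\<Sum>B\<in>UNIV. f B)"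
  for f :: "'n::finite set \<Rightarrow> 'b::comm_monoid_add"
  by (rule sum.reindex_bij_betw[OF bij_sym_diff])

instantiation clifford :: ("{finite,linorder}") real_algebra_1
begin

definition one_clifford :: "'a clifford"
  where "1 = blade {}"

lift_definition times_clifford :: "'a clifford \<Rightarrow> 'a clifford \<Rightarrow> 'a clifford"
  is "\<lambda>a b C. \<Sum>A\<in>UNIV. blade_sign A (sym_diff A C) * a A * b (sym_diff A C)" .

lemma coord_times:
  "coord (a * b) C =
    (\<Sum>A\<in>UNIV. blade_sign A (sym_diff A C) * coord a A * coord b (sym_diff A C))"
  by transfer simp

instance
proof
  fix a b c :: "'a clifford" and r :: real
  show "a * b * c = a * (b * c)"
  proof (rule clifford_eqI)
    fix D
    have sd: "sym_diff A (sym_diff A X) = X" for A X :: "'a set"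
      by auto
    have "coord (a * b * c) D = (\<Sum>C\<in>UNIV. \<Sum>A\<in>UNIV. blade_sign C (sym_diff C D) *
        blade_sign A (sym_diff A C) * coord a A * coord b (sym_diff A C) * coord c (sym_diff C D))"
      by (simp add: coord_times sum_distrib_left sum_distrib_right mult_ac)
    also have "\<dots> = (\<Sum>A\<in>UNIV. \<Sum>C\<in>UNIV. blade_sign C (sym_diff C D) *
        blade_sign A (sym_diff A C) * coord a A * coord b (sym_diff A C) * coord c (sym_diff C D))"
      by (rule sum.swap)
    also have "\<dots> = (\<Sum>A\<in>UNIV. \<Sum>B\<in>UNIV. blade_sign (sym_diff A B) (sym_diff (sym_diff A B) D) *
        blade_sign A B * coord a A * coord b B * coord c (sym_diff (sym_diff A B) D))"
    proof (rule sum.cong[OF refl], goal_cases)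
      case (1 A)
      show ?case
        by (rule trans[OF sum_sym_diff[symmetric, where A = A]]) (simp only: sd)
    qed
    also have "\<dots> = (\<Sum>A\<in>UNIV. \<Sum>B\<in>UNIV. blade_sign A (sym_diff A D) *
        blade_sign B (sym_diff B (sym_diff A D)) * coord a A * coord b B *
        coord c (sym_diff B (sym_diff A D)))"
    proof (intro sum.cong refl)
      fix A B :: "'a set"
      define X where "X = sym_diff B (sym_diff A D)"
      have 1: "sym_diff (sym_diff A B) D = X" "sym_diff A D = sym_diff B X"
        unfolding X_def by auto
      have "blade_sign (sym_diff A B) X * blade_sign A B = blade_sign A (sym_diff B X) * blade_sign B X"
        unfolding blade_sign_sym_diff_left blade_sign_sym_diff_right by simp
      then show "blade_sign (sym_diff A B) (sym_diff (sym_diff A B) D) *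
        blade_sign A B * coord a A * coord b B * coord c (sym_diff (sym_diff A B) D) =
        blade_sign A (sym_diff A D) *
        blade_sign B (sym_diff B (sym_diff A D)) * coord a A * coord b B *
        coord c (sym_diff B (sym_diff A D))"
        unfolding 1(1) X_def[symmetric] unfolding 1(2) by simp
    qed
    also have "\<dots> = coord (a * (b * c)) D"
      by (simp add: coord_times sum_distrib_left mult_ac)
    finally show "coord (a * b * c) D = coord (a * (b * c)) D" .
  qed
  show "(a + b) * c = a * c + b * c" "a * (b + c) = a * b + a * c"
    by (auto intro!: clifford_eqI simp: coord_times algebra_simps sum.distrib)
  show "r *\<^sub>R a * b = r *\<^sub>R (a * b)" "a * r *\<^sub>R b = r *\<^sub>R (a * b)"
    by (auto intro!: clifford_eqI simp: coord_times sum_distrib_left mult_ac)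
  show "1 * a = a"
  proof (rule clifford_eqI)
    fix C
    have "coord (1 * a) C =
        (\<Sum>A\<in>UNIV. if A = {} then blade_sign A (sym_diff A C) * coord a (sym_diff A C) else 0)"
      unfolding coord_times one_clifford_def by (intro sum.cong) auto
    then show "coord (1 * a) C = coord a C"
      by (simp add: blade_sign_def)
  qed
  show "a * 1 = a"
  proof (rule clifford_eqI)
    fix C
    have eq: "sym_diff A C = {} \<longleftrightarrow> A = C" for A :: "'a set"
      by auto
    have "coord (a * 1) C = (\<Sum>A\<in>UNIV. if A = C then blade_sign A {} * coord a A else 0)"
      unfolding coord_times one_clifford_def by (intro sum.cong) (auto simp: eq)
    then show "coord (a * 1) C = coord a C"
      by (simp add: blade_sign_def)
  qed
  show "(0 :: 'a clifford) \<noteq> 1"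
    by (metis coord_blade coord_simps(1) one_clifford_def zero_neq_one)
qed

end

definition gen :: "'n::finite \<Rightarrow> 'n clifford"
  where "gen i = blade {i}"

lemma blade_times_blade: "blade A * blade B = blade_sign A B *\<^sub>R blade (sym_diff A B)"
proof (rule clifford_eqI)
  fix C
  have eq: "sym_diff A C = B \<longleftrightarrow> C = sym_diff A B"
    by auto
  have "coord (blade A * blade B) C =
      (\<Sum>A'\<in>UNIV. if A' = A then blade_sign A (sym_diff A C) * coord (blade B) (sym_diff A C) else 0)"
    unfolding coord_times by (intro sum.cong) auto
  also have "\<dots> = coord (blade_sign A B *\<^sub>R blade (sym_diff A B)) C"
    using eq by auto
  finally show "coord (blade A * blade B) C = coord (blade_sign A B *\<^sub>R blade (sym_diff A B)) C" .
qed

lemma gen_square: "gen i * gen i = - 1"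
  by (simp add: gen_def blade_times_blade blade_sign_def one_clifford_def)

lemma gen_anticommute: "i \<noteq> j \<Longrightarrow> gen i * gen j = - (gen j * gen i)"
  by (auto simp: gen_def blade_times_blade blade_sign_def Un_commute)

lemma blade_eq_prod_gen: "blade A = prod_list (map gen (sorted_list_of_set A))"
proof -
  have "finite A" by simp
  then show ?thesis
  proof (induction A rule: finite_linorder_min_induct)
    case empty
    then show ?case by (simp add: one_clifford_def)
  next
    case (insert b A)
    have "sorted_list_of_set (insert b A) = b # sorted_list_of_set A"
      using insert by (auto intro: sorted_list_of_set_insert_remove simp: insort_is_Cons less_imp_le)
    moreover have "gen b * blade A = blade (insert b A)"
    proof -
      have "b \<notin> A" using insert by auto
      moreover have "blade_sign {b} A = 1"
        using insert by (auto simp: blade_sign_def intro!: prod.neutral)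
      ultimately show ?thesis
        by (simp add: gen_def blade_times_blade)
    qed
    ultimately show ?case
      using insert by simp
  qed
qed

lemma clifford_expansion: "a = (\<Sum>A\<in>UNIV. coord a A *\<^sub>R blade A)"
  by (rule clifford_eqI) (simp add: coord_sum if_distrib cong: if_cong)


section \<open>Partial derivatives and the Dirac operator on the half space\<close>

text \<open>
  A point \<open>(x, y)\<close> is a vector \<open>p :: real ^ 'n\<close>. The last index \<open>Max UNIV\<close> plays the role of \<open>n\<close>:
  \<open>y\<close> is the coordinate of \<open>p\<close> at that index, and the other coordinates form \<open>x\<close>.
\<close>

definition last_index :: "'n::{finite,linorder}"
  where "last_index = Max UNIV"

definition upper_half_space :: "(real ^ 'n::{finite,linorder}) set"
  where "upper_half_space = {p. p $ last_index > 0}"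

definition has_partial :: "'n \<Rightarrow> (real ^ 'n \<Rightarrow> 'b::real_normed_vector) \<Rightarrow> real ^ 'n::finite \<Rightarrow> bool"
  where "has_partial i F p \<longleftrightarrow> (\<lambda>t. F (p + t *\<^sub>R axis i 1)) differentiable (at 0)"

definition partial :: "'n \<Rightarrow> (real ^ 'n \<Rightarrow> 'b::real_normed_vector) \<Rightarrow> real ^ 'n::finite \<Rightarrow> 'b"
  where "partial i F p = vector_derivative (\<lambda>t. F (p + t *\<^sub>R axis i 1)) (at 0)"

text \<open>\<open>C_on k F S\<close> expresses \<open>F \<in> C\<^sup>k(S)\<close> and is meant for open \<open>S\<close>.\<close>

primrec C_on :: "nat \<Rightarrow> (real ^ 'n \<Rightarrow> 'b::real_normed_vector) \<Rightarrow> (real ^ 'n::finite) set \<Rightarrow> bool"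
  where
    "C_on 0 F S \<longleftrightarrow> continuous_on S F"
  | "C_on (Suc k) F S \<longleftrightarrow>
      continuous_on S F \<and> (\<forall>i. (\<forall>p\<in>S. has_partial i F p) \<and> C_on k (partial i F) S)"

definition laplacian :: "(real ^ 'n \<Rightarrow> 'b::real_normed_vector) \<Rightarrow> real ^ 'n::finite \<Rightarrow> 'b"
  where "laplacian F p = (\<Sum>i\<in>UNIV. partial i (partial i F) p)"

definition alpha :: "nat \<Rightarrow> real"
  where "alpha n = (real n - 1) / 2"

definition beta :: "nat \<Rightarrow> real"
  where "beta n = alpha n + (alpha n)\<^sup>2"

lemma beta_eq: "beta n = (real n - 1) / 2 + (real n - 1)\<^sup>2 / 4"
  by (simp add: beta_def alpha_def power_divide)

definition dirac_H ::
    "(real ^ 'n::{finite,linorder} \<Rightarrow> 'n clifford) \<Rightarrow> real ^ 'n::{finite,linorder} \<Rightarrow> 'n clifford"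
  where "dirac_H F p =
    (\<Sum>i\<in>UNIV - {last_index}. gen i * (p $ last_index *\<^sub>R partial i F p))
    - alpha CARD('n) *\<^sub>R (gen last_index * F p)
    + gen last_index * (p $ last_index *\<^sub>R partial last_index F p)"

end

theory Submission
  imports Defs
begin

text \<open>
  Write \<open>e\<close> for the last generator, \<open>y\<close> for the last coordinate, \<open>\<alpha>\<close> for \<open>\<alpha>\<^sub>n\<close> and
  \<open>\<partial> = \<Sum>\<^sub>i e\<^sub>i \<partial>\<^sub>i\<close> (sum over all indices) for the Euclidean Dirac operator, so that
  \<open>D\<^sub>H F = y \<partial>F - \<alpha> e F\<close>. Three identities carry the computation:
  \<^item> the product rule \<open>\<partial>(y G) = e G + y \<partial>G\<close>;
  \<^item> \<open>\<partial>(e F) = - e \<partial>F - 2 \<partial>\<^sub>n F\<close>, since \<open>e\<close> anticommutes with every other generator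
    and \<open>e e = -1\<close> (\<open>sum_gen_last_mult\<close>);
  \<^item> \<open>\<partial>\<partial>F = - \<Delta>F\<close>, since the second partial derivatives are symmetric in their indices
    (\<open>mixed_partials_commute\<close>) while the products \<open>e\<^sub>i e\<^sub>j\<close> with \<open>i \<noteq> j\<close> are
    antisymmetric (\<open>sum_gen_gen_symmetric\<close>).

  Hence \<open>D\<^sub>H (D\<^sub>H F) = y (e \<partial>F - y \<Delta>F + \<alpha> e \<partial>F + 2 \<alpha> \<partial>\<^sub>n F) - \<alpha> y e \<partial>F - \<alpha>\<^sup>2 F
  = - y\<^sup>2 \<Delta>F + y e \<partial>F + 2 \<alpha> y \<partial>\<^sub>n F - \<alpha>\<^sup>2 F\<close>, and the claim follows from
  \<open>e D\<^sub>H F = y e \<partial>F + \<alpha> F\<close> and \<open>\<beta> = \<alpha> + \<alpha>\<^sup>2\<close>.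
\<close>

section \<open>Symmetry of the second partial derivatives\<close>

lemma has_partial_has_vector_derivative:
  assumes "has_partial i F p"
  shows "((\<lambda>t. F (p + t *\<^sub>R axis i 1)) has_vector_derivative partial i F p) (at 0)"
  using assms unfolding has_partial_def partial_def
  by (simp add: vector_derivative_works)

lemma partial_eqI:
  assumes "((\<lambda>t. F (p + t *\<^sub>R axis i 1)) has_vector_derivative D) (at 0)"
  shows "partial i F p = D"
  using assms unfolding partial_def by (rule vector_derivative_at)

lemma has_real_derivative_along_line:
  fixes f f' :: "'a::real_normed_vector \<Rightarrow> real"
  assumes "((\<lambda>t. f (x + s *\<^sub>R u + t *\<^sub>R u)) has_real_derivative f' (x + s *\<^sub>R u)) (at 0)"
  shows "((\<lambda>t. f (x + t *\<^sub>R u)) has_real_derivative f' (x + s *\<^sub>R u)) (at s)"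
proof -
  have "((\<lambda>t. f (x + (t + s) *\<^sub>R u)) has_real_derivative f' (x + s *\<^sub>R u)) (at 0)"
    using assms by (simp add: scaleR_add_left add_ac)
  then show ?thesis
    using DERIV_shift[of "\<lambda>t. f (x + t *\<^sub>R u)" "f' (x + s *\<^sub>R u)" 0 s] by simp
qed

text \<open>
  The mean value theorem, applied once in each direction, turns the second difference of \<open>f\<close> over a
  parallelogram into \<open>h\<^sup>2\<close> times a value of the iterated directional derivative. This difference is symmetric
  in \<open>u\<close> and \<open>v\<close>, which is the source of the symmetry of second derivatives.
\<close>

lemma second_difference_mvt:
  fixes f f1 f2 :: "'a::real_normed_vector \<Rightarrow> real"
  assumes h: "0 < h"
    and S: "\<And>s t. 0 \<le> s \<Longrightarrow> s \<le> h \<Longrightarrow> 0 \<le> t \<Longrightarrow> t \<le> h \<Longrightarrow> p + s *\<^sub>R u + t *\<^sub>R v \<in> S"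
    and f1: "\<And>x. x \<in> S \<Longrightarrow> ((\<lambda>t. f (x + t *\<^sub>R u)) has_real_derivative f1 x) (at 0)"
    and f2: "\<And>x. x \<in> S \<Longrightarrow> ((\<lambda>t. f1 (x + t *\<^sub>R v)) has_real_derivative f2 x) (at 0)"
  shows "\<exists>s t. 0 < s \<and> s < h \<and> 0 < t \<and> t < h \<and>
    f (p + h *\<^sub>R u + h *\<^sub>R v) - f (p + h *\<^sub>R u) - f (p + h *\<^sub>R v) + f p
      = h\<^sup>2 * f2 (p + s *\<^sub>R u + t *\<^sub>R v)"
proof -
  define g where "g s = f (p + h *\<^sub>R v + s *\<^sub>R u) - f (p + s *\<^sub>R u)" for s
  have "(g has_real_derivative f1 (p + h *\<^sub>R v + s *\<^sub>R u) - f1 (p + s *\<^sub>R u)) (at s)"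
    if "0 \<le> s" "s \<le> h" for s
  proof -
    have "p + h *\<^sub>R v + s *\<^sub>R u \<in> S" "p + s *\<^sub>R u \<in> S"
      using S[of s h] S[of s 0] that h by (simp_all add: add_ac)
    then show ?thesis
      unfolding g_def
      by (intro DERIV_diff has_real_derivative_along_line[where f = f and f' = f1, OF f1])
  qed
  then obtain s where s: "0 < s" "s < h"
    and gs: "g h - g 0 = (h - 0) * (f1 (p + h *\<^sub>R v + s *\<^sub>R u) - f1 (p + s *\<^sub>R u))"
    using MVT2[OF h, of g "\<lambda>s. f1 (p + h *\<^sub>R v + s *\<^sub>R u) - f1 (p + s *\<^sub>R u)"] by blast
  have "((\<lambda>t. f1 (p + s *\<^sub>R u + t *\<^sub>R v)) has_real_derivative f2 (p + s *\<^sub>R u + t *\<^sub>R v)) (at t)"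
    if "0 \<le> t" "t \<le> h" for t
    using S[of s t] s that
    by (intro has_real_derivative_along_line[where f = f1 and f' = f2, OF f2]) auto
  then obtain t where t: "0 < t" "t < h"
    and "f1 (p + s *\<^sub>R u + h *\<^sub>R v) - f1 (p + s *\<^sub>R u + 0 *\<^sub>R v)
      = (h - 0) * f2 (p + s *\<^sub>R u + t *\<^sub>R v)"
    using MVT2[OF h, of "\<lambda>t. f1 (p + s *\<^sub>R u + t *\<^sub>R v)"
        "\<lambda>t. f2 (p + s *\<^sub>R u + t *\<^sub>R v)"] by blast
  with gs have "g h - g 0 = h\<^sup>2 * f2 (p + s *\<^sub>R u + t *\<^sub>R v)"
    by (simp add: power2_eq_square add_ac)
  moreover have
    "g h - g 0 = f (p + h *\<^sub>R u + h *\<^sub>R v) - f (p + h *\<^sub>R u) - f (p + h *\<^sub>R v) + f p"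
    by (simp add: g_def add_ac)
  ultimately show ?thesis
    using s t by metis
qed

lemma mixed_directional_derivatives_commute:
  fixes f fu fv fuv fvu :: "'a::real_normed_vector \<Rightarrow> real"
  assumes S: "open S" "p \<in> S"
    and fu: "\<And>x. x \<in> S \<Longrightarrow> ((\<lambda>t. f (x + t *\<^sub>R u)) has_real_derivative fu x) (at 0)"
    and fv: "\<And>x. x \<in> S \<Longrightarrow> ((\<lambda>t. f (x + t *\<^sub>R v)) has_real_derivative fv x) (at 0)"
    and fuv: "\<And>x. x \<in> S \<Longrightarrow> ((\<lambda>t. fu (x + t *\<^sub>R v)) has_real_derivative fuv x) (at 0)"
    and fvu: "\<And>x. x \<in> S \<Longrightarrow> ((\<lambda>t. fv (x + t *\<^sub>R u)) has_real_derivative fvu x) (at 0)"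
    and cont: "continuous_on S fuv" "continuous_on S fvu"
  shows "fuv p = fvu p"
proof (rule ccontr)
  assume neq: "fuv p \<noteq> fvu p"
  define e where "e = \<bar>fuv p - fvu p\<bar> / 2"
  have e: "0 < e"
    using neq by (simp add: e_def)
  have "\<forall>\<^sub>F x in nhds p. x \<in> S \<and> dist (fuv x) (fuv p) < e \<and> dist (fvu x) (fvu p) < e"
  proof (intro eventually_conj)
    show "\<forall>\<^sub>F x in nhds p. x \<in> S"
      using S by (rule eventually_nhds_in_open)
    have "isCont fuv p" "isCont fvu p"
      using cont S by (auto simp: continuous_on_eq_continuous_at)
    then show "\<forall>\<^sub>F x in nhds p. dist (fuv x) (fuv p) < e"
      "\<forall>\<^sub>F x in nhds p. dist (fvu x) (fvu p) < e"
      using e by (auto simp: isCont_def tendsto_at_iff_tendsto_nhds dest!: tendstoD)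
  qed
  then obtain d where d: "0 < d"
    and near: "\<And>x. dist x p < d \<Longrightarrow>
      x \<in> S \<and> dist (fuv x) (fuv p) < e \<and> dist (fvu x) (fvu p) < e"
    unfolding eventually_nhds_metric by blast
  \<comment> \<open>This side parameter keeps the parallelogram inside the ball of radius \<open>d\<close> around \<open>p\<close>.\<close>
  define h where "h = d / (norm u + norm v + 1)"
  have n: "0 < norm u + norm v + 1"
    by (simp add: add_nonneg_pos)
  have h: "0 < h"
    using d n by (simp add: h_def)
  have close: "dist (p + s *\<^sub>R u + t *\<^sub>R v) p < d"
    if "0 \<le> s" "s \<le> h" "0 \<le> t" "t \<le> h" for s t
  proof -
    have "dist (p + s *\<^sub>R u + t *\<^sub>R v) p = norm (s *\<^sub>R u + t *\<^sub>R v)"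
      by (simp add: dist_norm add.assoc)
    also have "\<dots> \<le> s * norm u + t * norm v"
      using that by (intro norm_triangle_le) simp
    also have "\<dots> \<le> h * norm u + h * norm v"
      using that by (intro add_mono mult_right_mono) auto
    also have "\<dots> < h * (norm u + norm v + 1)"
      using h by (simp add: algebra_simps)
    also have "\<dots> = d"
      using n by (simp add: h_def)
    finally show ?thesis .
  qed
  have box: "p + s *\<^sub>R u + t *\<^sub>R v \<in> S" "p + t *\<^sub>R v + s *\<^sub>R u \<in> S"
    if "0 \<le> s" "s \<le> h" "0 \<le> t" "t \<le> h" for s t
    using near[OF close[OF that]] by (simp_all add: add_ac)
  obtain s t where st: "0 < s" "s < h" "0 < t" "t < h"
    and 1: "f (p + h *\<^sub>R u + h *\<^sub>R v) - f (p + h *\<^sub>R u) - f (p + h *\<^sub>R v) + f p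
      = h\<^sup>2 * fuv (p + s *\<^sub>R u + t *\<^sub>R v)"
    using second_difference_mvt[OF h box(1) fu fuv] by blast
  obtain t' s' where st': "0 < t'" "t' < h" "0 < s'" "s' < h"
    and 2: "f (p + h *\<^sub>R v + h *\<^sub>R u) - f (p + h *\<^sub>R v) - f (p + h *\<^sub>R u) + f p
      = h\<^sup>2 * fvu (p + t' *\<^sub>R v + s' *\<^sub>R u)"
    using second_difference_mvt[OF h box(2) fv fvu] by blast
  have "h\<^sup>2 * fuv (p + s *\<^sub>R u + t *\<^sub>R v) = h\<^sup>2 * fvu (p + s' *\<^sub>R u + t' *\<^sub>R v)"
    using 1 2 unfolding add.assoc add.commute[of "_ *\<^sub>R v" "_ *\<^sub>R u"] by linarith
  then have "fuv (p + s *\<^sub>R u + t *\<^sub>R v) = fvu (p + s' *\<^sub>R u + t' *\<^sub>R v)"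
    using h by simp
  moreover have "dist (fuv (p + s *\<^sub>R u + t *\<^sub>R v)) (fuv p) < e"
    using near close st by simp
  moreover have "dist (fvu (p + s' *\<^sub>R u + t' *\<^sub>R v)) (fvu p) < e"
    using near close st' by simp
  ultimately have "dist (fuv p) (fvu p) < e + e"
    by (metis dist_triangle_less_add dist_commute)
  then show False
    by (simp add: e_def dist_real_def)
qed

lemma has_real_derivative_inner_partial:
  fixes F :: "real ^ 'n::finite \<Rightarrow> 'b::real_inner"
  assumes "has_partial i F p"
  shows "((\<lambda>t. inner (F (p + t *\<^sub>R axis i 1)) b) has_real_derivative inner (partial i F p) b) (at 0)"
  using bounded_linear.has_vector_derivative
    [OF bounded_linear_inner_left has_partial_has_vector_derivative[OF assms]]
  by (simp add: has_real_derivative_iff_has_vector_derivative)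

lemma mixed_partials_commute:
  fixes F :: "real ^ 'n::finite \<Rightarrow> 'b::euclidean_space"
  assumes "open S" "C_on 2 F S" "p \<in> S"
  shows "partial i (partial j F) p = partial j (partial i F) p"
proof (rule euclidean_eqI)
  fix b :: 'b
  have hp: "has_partial k F x" "has_partial l (partial k F) x"
    and cont: "continuous_on S (partial l (partial k F))" if "x \<in> S" for k l x
    using assms(2) that by (auto simp: numeral_2_eq_2)
  show "inner (partial i (partial j F) p) b = inner (partial j (partial i F) p) b"
    by (rule mixed_directional_derivatives_commute[OF assms(1,3), where f = "\<lambda>x. inner (F x) b"
          and fu = "\<lambda>x. inner (partial j F x) b" and u = "axis j 1"
          and fv = "\<lambda>x. inner (partial i F x) b" and v = "axis i 1"])
      (auto intro!: has_real_derivative_inner_partial hp continuous_on_inner cont[OF assms(3)]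
        continuous_on_const)
qed

section \<open>Sums of generators\<close>

lemma sum_gen_gen_symmetric:
  fixes H :: "'n::{finite,linorder} \<Rightarrow> 'n \<Rightarrow> 'n clifford"
  assumes "\<And>i j. H i j = H j i"
  shows "(\<Sum>i\<in>UNIV. gen i * (\<Sum>j\<in>UNIV. gen j * H i j)) = - (\<Sum>i\<in>UNIV. H i i)"
proof -
  let ?S = "\<Sum>i\<in>UNIV. gen i * (\<Sum>j\<in>UNIV. gen j * H i j)"
  have S: "?S = (\<Sum>i\<in>UNIV. \<Sum>j\<in>UNIV. gen i * gen j * H i j)"
    by (simp add: sum_distrib_left mult.assoc)
  also have "\<dots> = (\<Sum>i\<in>UNIV. \<Sum>j\<in>UNIV. gen j * gen i * H i j)"
    by (subst sum.swap) (simp add: assms[of _ _])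
  finally have "?S + ?S = (\<Sum>i\<in>UNIV. \<Sum>j\<in>UNIV. (gen i * gen j + gen j * gen i) * H i j)"
    using S by (simp add: distrib_right sum.distrib)
  also have "\<dots> = (\<Sum>i\<in>UNIV. \<Sum>j\<in>UNIV. if j = i then - 2 *\<^sub>R H i i else 0)"
  proof (intro sum.cong refl)
    fix i j :: 'n
    show "(gen i * gen j + gen j * gen i) * H i j = (if j = i then - 2 *\<^sub>R H i i else 0)"
      using gen_anticommute[of i j]
      by (auto simp: gen_square scaleR_2 distrib_right)
  qed
  also have "\<dots> = 2 *\<^sub>R (- (\<Sum>i\<in>UNIV. H i i))"
    by (simp add: scaleR_sum_right sum_negf)
  finally have "2 *\<^sub>R ?S = 2 *\<^sub>R (- (\<Sum>i\<in>UNIV. H i i))"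
    by (simp only: scaleR_2)
  then show ?thesis
    by (rule scaleR_left_imp_eq[rotated]) simp
qed

lemma sum_gen_last_mult:
  fixes G :: "'n::{finite,linorder} \<Rightarrow> 'n clifford"
  shows "(\<Sum>i\<in>UNIV. gen i * (gen k * G i)) = - (gen k * (\<Sum>i\<in>UNIV. gen i * G i)) - 2 *\<^sub>R G k"
proof -
  have "gen i * (gen k * G i) = - (gen k * (gen i * G i)) - (if i = k then 2 *\<^sub>R G k else 0)" for i
    using gen_anticommute[of i k]
    by (auto simp: mult.assoc[symmetric] gen_square scaleR_2)
  then show ?thesis
    by (simp add: sum_subtractf sum_negf sum_distrib_left)
qed

section \<open>The square of the hyperbolic Dirac operator\<close>

text \<open>The Euclidean Dirac operator, including the last index.\<close>

definition dirac_E ::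
    "(real ^ 'n::{finite,linorder} \<Rightarrow> 'n clifford) \<Rightarrow> real ^ 'n::{finite,linorder} \<Rightarrow> 'n clifford"
  where "dirac_E F p = (\<Sum>i\<in>UNIV. gen i * partial i F p)"

lemma dirac_H_eq_dirac_E:
  fixes F :: "real ^ 'n::{finite,linorder} \<Rightarrow> 'n clifford"
  shows "dirac_H F p =
    p $ last_index *\<^sub>R dirac_E F p - alpha CARD('n) *\<^sub>R (gen last_index * F p)"
proof -
  have "dirac_E F p =
      gen last_index * partial last_index F p + (\<Sum>i\<in>UNIV - {last_index}. gen i * partial i F p)"
    unfolding dirac_E_def by (rule sum.remove) auto
  then show ?thesis
    by (simp add: dirac_H_def scaleR_add_right scaleR_sum_right)
qed

lemma has_vector_derivative_clifford_mult_left: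
  fixes a :: "'n::{finite,linorder} clifford"
  assumes "(f has_vector_derivative D) (at t)"
  shows "((\<lambda>t. a * f t) has_vector_derivative a * D) (at t)"
proof -
  \<comment> \<open>The norm is not submultiplicative in general; boundedness comes from finite dimension.\<close>
  have "bounded_linear (\<lambda>x. a * x)"
    unfolding linear_conv_bounded_linear[symmetric]
    by (rule linearI) (simp_all add: distrib_left)
  then show ?thesis
    using assms by (rule bounded_linear.has_vector_derivative)
qed

lemma partial_dirac_H:
  fixes F :: "real ^ 'n::{finite,linorder} \<Rightarrow> 'n clifford"
  assumes "has_partial i F p" "\<And>j. has_partial i (partial j F) p"
  shows "partial i (dirac_H F) p =
    (if i = last_index then dirac_E F p else 0)
    + p $ last_index *\<^sub>R (\<Sum>j\<in>UNIV. gen j * partial i (partial j F) p)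
    - alpha CARD('n) *\<^sub>R (gen last_index * partial i F p)"
proof (rule partial_eqI)
  let ?c = "\<lambda>t. p + t *\<^sub>R axis i 1"
  let ?d = "if i = last_index then 1 else 0 :: real"
  have y: "((\<lambda>t. ?c t $ last_index) has_real_derivative ?d) (at 0)"
    by (auto simp: axis_def intro!: derivative_eq_intros)
  have E: "((\<lambda>t. dirac_E F (?c t)) has_vector_derivative
      (\<Sum>j\<in>UNIV. gen j * partial i (partial j F) p)) (at 0)"
    unfolding dirac_E_def
    by (intro has_vector_derivative_sum has_vector_derivative_clifford_mult_left
        has_partial_has_vector_derivative assms)
  have M: "((\<lambda>t. alpha CARD('n) *\<^sub>R (gen last_index * F (?c t))) has_vector_derivative
      alpha CARD('n) *\<^sub>R (gen last_index * partial i F p)) (at 0)"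
    by (intro bounded_linear.has_vector_derivative[OF bounded_linear_scaleR_right]
        has_vector_derivative_clifford_mult_left has_partial_has_vector_derivative assms)
  show "((\<lambda>t. dirac_H F (?c t)) has_vector_derivative
    (if i = last_index then dirac_E F p else 0)
    + p $ last_index *\<^sub>R (\<Sum>j\<in>UNIV. gen j * partial i (partial j F) p)
    - alpha CARD('n) *\<^sub>R (gen last_index * partial i F p)) (at 0)"
    unfolding dirac_H_eq_dirac_E
    using has_vector_derivative_diff[OF has_vector_derivative_scaleR[OF y E] M]
    by (cases "i = last_index") (simp_all add: add.commute[of "dirac_E F p"])
qed

lemma dirac_E_dirac_H:
  fixes F :: "real ^ 'n::{finite,linorder} \<Rightarrow> 'n clifford"
  assumes "open \<Omega>" "C_on 2 F \<Omega>" "p \<in> \<Omega>"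
  shows "dirac_E (dirac_H F) p =
    gen last_index * dirac_E F p - p $ last_index *\<^sub>R laplacian F p
    + alpha CARD('n) *\<^sub>R (gen last_index * dirac_E F p + 2 *\<^sub>R partial last_index F p)"
proof -
  let ?H = "\<lambda>i j. partial i (partial j F) p"
  have hp: "has_partial i F p" "has_partial i (partial j F) p" for i j
    using assms by (auto simp: numeral_2_eq_2)
  have "gen i * partial i (dirac_H F) p =
      (if i = last_index then gen last_index * dirac_E F p else 0)
      + p $ last_index *\<^sub>R (gen i * (\<Sum>j\<in>UNIV. gen j * ?H i j))
      - alpha CARD('n) *\<^sub>R (gen i * (gen last_index * partial i F p))" for i
    by (simp add: partial_dirac_H hp distrib_left right_diff_distrib)
  then have "dirac_E (dirac_H F) p =
      gen last_index * dirac_E F p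
      + p $ last_index *\<^sub>R (\<Sum>i\<in>UNIV. gen i * (\<Sum>j\<in>UNIV. gen j * ?H i j))
      - alpha CARD('n) *\<^sub>R (\<Sum>i\<in>UNIV. gen i * (gen last_index * partial i F p))"
    by (simp add: dirac_E_def[of "dirac_H F"] sum.distrib sum_subtractf scaleR_sum_right)
  moreover have "(\<Sum>i\<in>UNIV. gen i * (\<Sum>j\<in>UNIV. gen j * ?H i j)) = - laplacian F p"
    unfolding laplacian_def
    by (rule sum_gen_gen_symmetric) (rule mixed_partials_commute[OF assms])
  moreover have "(\<Sum>i\<in>UNIV. gen i * (gen last_index * partial i F p)) =
      - (gen last_index * dirac_E F p) - 2 *\<^sub>R partial last_index F p"
    unfolding dirac_E_def by (rule sum_gen_last_mult)
  ultimately show ?thesis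
    by (simp add: scaleR_add_right scaleR_diff_right)
qed

theorem lemma4p2:
  fixes F :: "real ^ 'n::{finite,linorder} \<Rightarrow> 'n clifford"
    and \<Omega> :: "(real ^ 'n::{finite,linorder}) set"
  assumes "CARD('n) \<ge> 2"
    and "open \<Omega>" and "\<Omega> \<subseteq> upper_half_space"
    and "C_on 2 F \<Omega>"
  shows "\<forall>p\<in>\<Omega>. dirac_H (dirac_H F) p =
    - ((p $ last_index)\<^sup>2 *\<^sub>R laplacian F p)
    + gen last_index * dirac_H F p
    + (2 * alpha CARD('n) * p $ last_index) *\<^sub>R partial last_index F p
    - beta CARD('n) *\<^sub>R F p"
proof
  fix p assume p: "p \<in> \<Omega>"
  let ?e = "gen last_index :: 'n clifford" and ?a = "alpha CARD('n)" and ?y = "p $ last_index"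
  have ee: "?e * (?e * X) = - X" for X
    by (simp add: mult.assoc[symmetric] gen_square)
  have eH: "?e * dirac_H F p = ?y *\<^sub>R (?e * dirac_E F p) + ?a *\<^sub>R F p"
    by (simp add: dirac_H_eq_dirac_E right_diff_distrib ee)
  have "dirac_H (dirac_H F) p = ?y *\<^sub>R dirac_E (dirac_H F) p - ?a *\<^sub>R (?e * dirac_H F p)"
    by (rule dirac_H_eq_dirac_E)
  then show "dirac_H (dirac_H F) p =
    - (?y\<^sup>2 *\<^sub>R laplacian F p) + ?e * dirac_H F p
    + (2 * ?a * ?y) *\<^sub>R partial last_index F p - beta CARD('n) *\<^sub>R F p"
    unfolding eH dirac_E_dirac_H[OF assms(2,4) p]
    by (simp add: beta_def power2_eq_square scaleR_add_left scaleR_add_right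
      scaleR_diff_right mult_ac)
qed

end
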